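(* Let $M$ be a finite set of prime numbers and let $p_j\in M$. For every integer $K\ge 1$, $$f_M\!\left(K\cdot\frac{\prod_{p_i\in M}p_i}{p_j-1}\right) = f_{M\setminus\{p_j\}}\!\left(K\cdot\prod_{p_i\in M\setminus\{p_j\}}p_i\right).$$
   Context: For a finite set $S$ of primes and a real number $x\ge 0$, $f_S(x)$ denotes the number of positive integers $\le x$ that are not divisible by any prime in $S$. An empty product equals $1$. *)

theory Defs
  imports Complex_Main "HOL-Computational_Algebra.Primes"
begin

definition unsieved_count :: "nat set \<Rightarrow> real \<Rightarrow> nat" where
  "unsieved_count S x = card {n :: nat. 0 < n \<and> real n \<le> x \<and> (\<forall>p\<in>S. \<not> p dvd n)}"

end

theory Submission
  imports Defs
begin

text \<open>Write \<open>M' = M - {q}\<close>, \<open>P\<close> for the product of \<open>M'\<close> and \<open>x = K q P / (q - 1)\<close>.  Sieving by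
  \<open>q\<close> gives \<open>f\<^sub>M(x) = f\<^sub>M'(x) - f\<^sub>M'(x / q)\<close>.  Since \<open>x = x / q + K P\<close> and coprimality to \<open>M'\<close> is
  periodic modulo \<open>P\<close>, also \<open>f\<^sub>M'(x) = f\<^sub>M'(x / q) + f\<^sub>M'(K P)\<close>.\<close>

lemma finite_unsieved:
  "finite {n :: nat. 0 < n \<and> real n \<le> x \<and> (\<forall>p\<in>S. \<not> p dvd n)}"
proof (rule finite_subset)
  show "{n :: nat. 0 < n \<and> real n \<le> x \<and> (\<forall>p\<in>S. \<not> p dvd n)} \<subseteq> {..nat \<lfloor>x\<rfloor>}"
    by (auto simp: le_nat_floor)
qed simp

text \<open>Shifting by \<open>N\<close> preserves divisibility by every \<open>p\<close> in
  \<open>S\<close>, so the unsieved numbers in (N, y + N] are the translates of those in (0, y].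
  Here \<open>y\<close> may be any nonnegative real; only the shift has to be an integer.\<close>

lemma unsieved_count_add_multiple:
  assumes "\<And>p. p \<in> S \<Longrightarrow> p dvd N" and "y \<ge> 0"
  shows "unsieved_count S (y + real N) = unsieved_count S y + unsieved_count S (real N)"
proof -
  let ?A = "\<lambda>x. {n :: nat. 0 < n \<and> real n \<le> x \<and> (\<forall>p\<in>S. \<not> p dvd n)}"
  have "?A (y + real N) = (+) N ` ?A y \<union> ?A (real N)"
  proof (rule set_eqI)
    fix n
    show "n \<in> ?A (y + real N) \<longleftrightarrow> n \<in> (+) N ` ?A y \<union> ?A (real N)"
    proof (cases "n \<le> N")
      case True
      \<comment> \<open>Translates of positive numbers exceed \<open>N\<close>, so only the second
        set can contain \<open>n\<close>; \<open>y \<ge> 0\<close> makes the bound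
        \<open>y + real N\<close> automatic.\<close>
      then show ?thesis using assms(2) by auto
    next
      case False
      then obtain m where m: "n = N + m" "m > 0"
        using less_imp_add_positive[of N n] by auto
      have "p dvd n \<longleftrightarrow> p dvd m" if "p \<in> S" for p
        using assms(1)[OF that] m(1) by (simp add: dvd_add_right_iff)
      then show ?thesis using m by auto
    qed
  qed
  moreover have "(+) N ` ?A y \<inter> ?A (real N) = {}"
    by auto
  ultimately show ?thesis
    unfolding unsieved_count_def
    by (simp add: card_Un_disjoint card_image finite_unsieved)
qed

text \<open>Split by divisibility by \<open>q\<close>: the multiples \<open>q * m\<close> up to
  \<open>x\<close> correspond to \<open>m\<close> up to \<open>x / q\<close>, and the factor
  \<open>q\<close> is invisible to the other primes.\<close>

lemma unsieved_count_insert_prime: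
  assumes "\<And>p. p \<in> S \<Longrightarrow> prime p" and "prime q" and "q \<notin> S"
  shows "unsieved_count S x = unsieved_count (insert q S) x + unsieved_count S (x / real q)"
proof -
  let ?A = "\<lambda>S x. {n :: nat. 0 < n \<and> real n \<le> x \<and> (\<forall>p\<in>S. \<not> p dvd n)}"
  have q: "q > 0" using assms(2) prime_gt_0_nat by blast
  \<comment> \<open>A prime \<open>p\<close> dividing the prime \<open>q\<close> would equal it,
    contradicting \<open>q \<notin> S\<close>.\<close>
  have dvd_iff: "p dvd q * m \<longleftrightarrow> p dvd m" if "p \<in> S" for p m
    using assms(1)[OF that] assms(2,3) that prime_dvd_mult_iff[of p q m] primes_dvd_imp_eq[of p q]
    by auto
  have "?A S x = ?A (insert q S) x \<union> (*) q ` ?A S (x / real q)"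
  proof (rule set_eqI)
    fix n
    show "n \<in> ?A S x \<longleftrightarrow> n \<in> ?A (insert q S) x \<union> (*) q ` ?A S (x / real q)"
    proof (cases "q dvd n")
      case False
      then show ?thesis by auto
    next
      case True
      then obtain m where "n = q * m" ..
      then show ?thesis using q dvd_iff by (auto simp: field_simps)
    qed
  qed
  moreover have "?A (insert q S) x \<inter> (*) q ` ?A S (x / real q) = {}"
    by auto
  moreover have "inj_on ((*) q) (?A S (x / real q))"
    using q by (simp add: inj_on_def)
  ultimately show ?thesis
    unfolding unsieved_count_def
    by (simp only: card_Un_disjoint card_image finite_unsieved finite_imageI)
qed

theorem mainTheorem16:
  fixes M :: "nat set" and q K :: nat
  assumes "finite M" and "\<And>p. p \<in> M \<Longrightarrow> prime p"
    and "q \<in> M" and "K \<ge> 1"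
  shows "unsieved_count M (real K * ((\<Prod>p\<in>M. real p) / (real q - 1))) =
         unsieved_count (M - {q}) (real K * (\<Prod>p\<in>M - {q}. real p))"
proof -
  define M' where "M' = M - {q}"
  define N where "N = K * \<Prod>M'"
  \<comment> \<open>This is \<open>x / q\<close> in the overview, characterised by (q - 1) y =
    N.\<close>
  define y where "y = real N / (real q - 1)"
  have q: "real q > 1" using assms(2,3) prime_gt_1_nat by fastforce
  have M: "M = insert q M'" using assms(3) by (auto simp: M'_def)
  have N: "real K * (\<Prod>p\<in>M'. real p) = real N"
    by (simp add: N_def)
  have "(\<Prod>p\<in>M. real p) = real q * (\<Prod>p\<in>M'. real p)"
    using assms(1,3) by (simp add: M'_def prod.remove)
  then have x: "real K * ((\<Prod>p\<in>M. real p) / (real q - 1)) = real q * y"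
    unfolding y_def N[symmetric] by simp
  have "unsieved_count M' (real q * y) = unsieved_count M (real q * y) + unsieved_count M' y"
  proof -
    have "prime p" if "p \<in> M'" for p
      using that assms(2) by (simp add: M'_def)
    moreover have "q \<notin> M'"
      by (simp add: M'_def)
    ultimately show ?thesis
      using unsieved_count_insert_prime[of M' q "real q * y"] assms(2)[OF assms(3)] q
      by (simp flip: M)
  qed
  moreover have "unsieved_count M' (y + real N) = unsieved_count M' y + unsieved_count M' (real N)"
  proof (rule unsieved_count_add_multiple)
    show "p dvd N" if "p \<in> M'" for p
      using dvd_prodI[OF _ that, of "\<lambda>p. p"] assms(1) by (simp add: N_def M'_def)
    show "y \<ge> 0" using q by (simp add: y_def)
  qed
  moreover have "y + real N = real q * y"
    using q by (simp add: y_def field_simps)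
  \<comment> \<open>Both decompositions count the same set and share the term
    \<open>unsieved_count M' y\<close>, which cancels.\<close>
  ultimately show ?thesis
    unfolding x M'_def[symmetric] N by simp
qed

end
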